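(* Consider two reflected backward stochastic difference equations (RBSDEs) with standard data $(\xi^1,f^1,S^1)$ and $(\xi^2,f^2,S^2)$ respectively, and let $(Y^1,Z^1,K^1)$ and $(Y^2,Z^2,K^2)$ be associated solutions. Suppose that $P$-a.s. for all $t$ (with $0\le t<T$ in (iv)): (i) $\xi^1\ge\xi^2$; (ii) $f^1(t,Y_t^2,Z_t^2)\ge f^2(t,Y_t^2,Z_t^2)$; (iii) $S_t^1\ge S_t^2$; (iv) $f^1(t,Y_t^2,Z_t^1)-f^1(t,Y_t^2,Z_t^2)\ge\min_{i\in\mathcal{Q}_t}\{(Z_t^1-Z_t^2)^*(e_i-E[X_{t+1}\mid\mathcal{F}_t])\}$; (v) if $Y_t^1-f^1(t,Y_t^1,Z_t^1)\ge Y_t^2-f^1(t,Y_t^2,Z_t^1)$, then $Y_t^1\ge Y_t^2$. Then, for all $t\in\{0,1,\dots,T\}$, $Y_t^1\ge Y_t^2$ $P$-a.s.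
   Context: Setting: $T$ is a positive integer, $m\ge 1$, and $X=(X_t)_{0\le t\le T}$ is a stochastic process with values in the set of standard basis vectors $\{e_1,\dots,e_m\}$ of $\mathbb{R}^m$ on a probability space $(\Omega,\mathcal{F},P)$; $\mathcal{F}_t$ is the completion of $\sigma(X_0,\dots,X_t)$ and $\mathcal{F}=\mathcal{F}_T$. $M_t=X_t-E[X_t\mid\mathcal{F}_{t-1}]$ for $t=1,\dots,T$. $[\cdot]^*$ denotes transposition. For $0\le t<T$, $\mathcal{Q}_t=\{i: P(X_{t+1}=e_i\mid\mathcal{F}_t)>0\}$ is the ($\mathcal{F}_t$-measurable, random) set of indices of possible values of $X_{t+1}$. Standard data: a triple $(\xi,f,S)$ where $\xi\in L^1(\mathcal{F}_T;\mathbb{R})$; $f:\Omega\times\{0,\dots,T\}\times\mathbb{R}\times\mathbb{R}^m\to\mathbb{R}$ is such that $f(\cdot,y,z)$ is an adapted process for every $(y,z)$; and $S=(S_t)_{0\le t\le T}$ (the obstacle) is a real-valued adapted process with $S_T\le\xi$ $P$-a.s. Solution of the RBSDE with data $(\xi,f,S)$: adapted processes $(Y_t,Z_t,K_t)_{0\le t\le T}$ with values in $\mathbb{R}\times\mathbb{R}^m\times\mathbb{R}$ such that for all $0\le t\le T$: (a) $Y_t=\xi+\sum_{t\le u<T}f(u,Y_u,Z_u)+K_T-K_t-\sum_{t\le u<T}Z_u^*M_{u+1}$ $P$-a.s.; (b) $Y_t,Z_t,K_t$ are integrable; (c) $Y_t\ge S_t$ $P$-a.s.; (d) $K$ is increasing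 (non-decreasing) in $t$, $K_0=0$, and $\sum_{0\le t<T}(Y_t-S_t)(K_{t+1}-K_t)=0$ $P$-a.s. *)

theory Defs
  imports "HOL-Probability.Probability"
begin

definition natural_sigma ::
  "'a measure \<Rightarrow> (nat \<Rightarrow> 'a \<Rightarrow> real ^ 'm) \<Rightarrow> nat \<Rightarrow> 'a measure" where
  "natural_sigma M X t =
     sigma (space M) (\<Union>s\<in>{..t}. sets (vimage_algebra (space M) (X s) borel))"

(* The completion of sigma(X_0, ..., X_t) with respect to the restriction of the
   probability to that sigma-algebra. *)
definition filt ::
  "'a measure \<Rightarrow> (nat \<Rightarrow> 'a \<Rightarrow> real ^ 'm) \<Rightarrow> nat \<Rightarrow> 'a measure" where
  "filt M X t = completion (restr_to_subalg M (natural_sigma M X t))"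

locale finite_state_process = prob_space M
  for M :: "'a measure" +
  fixes X :: "nat \<Rightarrow> 'a \<Rightarrow> real ^ 'm" and T :: nat
  assumes T_pos: "0 < T"
    and X_measurable: "\<And>t. t \<le> T \<Longrightarrow> X t \<in> borel_measurable M"
    and X_basis: "\<And>t \<omega>. t \<le> T \<Longrightarrow> \<omega> \<in> space M \<Longrightarrow> \<exists>i. X t \<omega> = axis i 1"
    and sets_eq_filt: "sets M = sets (filt M X T)"

(* The library's conditional expectation is real-valued; vectors are treated
   componentwise. *)
definition vec_cond_exp ::
  "'a measure \<Rightarrow> 'a measure \<Rightarrow> ('a \<Rightarrow> real ^ 'm) \<Rightarrow> 'a \<Rightarrow> real ^ 'm" where
  "vec_cond_exp M F V \<omega> = (\<chi> i. real_cond_exp M F (\<lambda>\<omega>'. V \<omega>' $ i) \<omega>)"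

(* Only meaningful for t >= 1. *)
definition mart_diff ::
  "'a measure \<Rightarrow> (nat \<Rightarrow> 'a \<Rightarrow> real ^ 'm) \<Rightarrow> nat \<Rightarrow> 'a \<Rightarrow> real ^ 'm" where
  "mart_diff M X t \<omega> = X t \<omega> - vec_cond_exp M (filt M X (t - 1)) (X t) \<omega>"

(* The conditional probability is the library's fixed version of
   E[1_{X_{t+1} = e_i} | F_t]; in particular the set is nonempty only almost surely. *)
definition possible_next ::
  "'a measure \<Rightarrow> (nat \<Rightarrow> 'a \<Rightarrow> real ^ 'm) \<Rightarrow> nat \<Rightarrow> 'a \<Rightarrow> 'm set" where
  "possible_next M X t \<omega> =
     {i. 0 < real_cond_exp M (filt M X t)
               (indicator {\<omega>' \<in> space M. X (Suc t) \<omega>' = axis i 1}) \<omega>}"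

definition adapted ::
  "'a measure \<Rightarrow> (nat \<Rightarrow> 'a \<Rightarrow> real ^ 'm) \<Rightarrow> nat
     \<Rightarrow> (nat \<Rightarrow> 'a \<Rightarrow> 'b::topological_space) \<Rightarrow> bool" where
  "adapted M X T V \<longleftrightarrow> (\<forall>t\<le>T. V t \<in> borel_measurable (filt M X t))"

definition standard_data ::
  "'a measure \<Rightarrow> (nat \<Rightarrow> 'a \<Rightarrow> real ^ 'm) \<Rightarrow> nat
     \<Rightarrow> ('a \<Rightarrow> real) \<Rightarrow> ('a \<Rightarrow> nat \<Rightarrow> real \<Rightarrow> real ^ 'm \<Rightarrow> real) \<Rightarrow> (nat \<Rightarrow> 'a \<Rightarrow> real) \<Rightarrow> bool" where
  "standard_data M X T \<xi> f S \<longleftrightarrow>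
     \<xi> \<in> borel_measurable (filt M X T) \<and> integrable M \<xi> \<and>
     (\<forall>y z. adapted M X T (\<lambda>t \<omega>. f \<omega> t y z)) \<and>
     adapted M X T S \<and>
     (AE \<omega> in M. S T \<omega> \<le> \<xi> \<omega>)"

definition rbsde_solution ::
  "'a measure \<Rightarrow> (nat \<Rightarrow> 'a \<Rightarrow> real ^ 'm) \<Rightarrow> nat
     \<Rightarrow> ('a \<Rightarrow> real) \<Rightarrow> ('a \<Rightarrow> nat \<Rightarrow> real \<Rightarrow> real ^ 'm \<Rightarrow> real) \<Rightarrow> (nat \<Rightarrow> 'a \<Rightarrow> real)
     \<Rightarrow> (nat \<Rightarrow> 'a \<Rightarrow> real) \<Rightarrow> (nat \<Rightarrow> 'a \<Rightarrow> real ^ 'm) \<Rightarrow> (nat \<Rightarrow> 'a \<Rightarrow> real) \<Rightarrow> bool" where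
  "rbsde_solution M X T \<xi> f S Y Z K \<longleftrightarrow>
     adapted M X T Y \<and> adapted M X T Z \<and> adapted M X T K \<and>
     (\<forall>t\<le>T. AE \<omega> in M.
        Y t \<omega> = \<xi> \<omega> + (\<Sum>u\<in>{t..<T}. f \<omega> u (Y u \<omega>) (Z u \<omega>)) + K T \<omega> - K t \<omega>
                 - (\<Sum>u\<in>{t..<T}. Z u \<omega> \<bullet> mart_diff M X (Suc u) \<omega>)) \<and>
     (\<forall>t\<le>T. integrable M (Y t) \<and> integrable M (Z t) \<and> integrable M (K t)) \<and>
     (\<forall>t\<le>T. AE \<omega> in M. S t \<omega> \<le> Y t \<omega>) \<and>
     (AE \<omega> in M. (\<forall>s t. s \<le> t \<and> t \<le> T \<longrightarrow> K s \<omega> \<le> K t \<omega>) \<and> K 0 \<omega> = 0 \<and>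
        (\<Sum>t\<in>{0..<T}. (Y t \<omega> - S t \<omega>) * (K (Suc t) \<omega> - K t \<omega>)) = 0)"

end

theory Submission
  imports Defs
begin

text \<open>Backward induction on \<open>t\<close>. On the event \<open>Y1 t < Y2 t\<close> the second solution lies strictly above
  its obstacle, so \<open>K2\<close> does not increase there. Subtracting the one-step equations and using the
  order at time \<open>t + 1\<close>, the quantity
  \<open>D = (Y1 t - f1 t (Y1 t) (Z1 t)) - (Y2 t - f1 t (Y2 t) (Z1 t))\<close>
  is at least the minimum of \<open>(Z1 t - Z2 t) \<bullet> (e\<^sub>i - E[X (t+1) | F\<^sub>t])\<close> over the possible next
  states minus its realised value. Since \<open>D\<close> is known at time \<open>t\<close> and the minimising state is reached
  with positive conditional probability, \<open>D \<ge> 0\<close>, and hypothesis (v) excludes the event.\<close>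

section \<open>Modifications on null sets and conditional probabilities\<close>

lemma (in complete_measure) measurable_cong_AE_borel:
  fixes f g :: "'a \<Rightarrow> 'b::topological_space"
  assumes f: "f \<in> borel_measurable M" and eq: "AE x in M. f x = g x"
  shows "g \<in> borel_measurable M"
proof (rule measurableI)
  fix A :: "'b set" assume A: "A \<in> sets borel"
  show "g -` A \<inter> space M \<in> sets M"
  proof (rule in_sets_AE)
    show "f -` A \<inter> space M \<in> sets M"
      using f A by (rule measurable_sets)
    show "AE x in M. x \<in> f -` A \<inter> space M \<longleftrightarrow> x \<in> g -` A \<inter> space M"
      using eq by eventually_elim auto
  qed auto
qed auto

text \<open>The real-valued case is applied to each coordinate; since the basis is finite, the
  exceptional null sets unite to a null set. It serves later for the pair of arguments
  \<open>(y, z)\<close> of a generator.\<close>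

lemma completion_ex_borel_measurable_euclidean:
  fixes g :: "'a \<Rightarrow> 'b::euclidean_space"
  assumes "g \<in> borel_measurable (completion M)"
  shows "\<exists>g'\<in>borel_measurable M. AE x in M. g x = g' x"
proof -
  have "\<exists>h\<in>borel_measurable M. AE x in M. g x \<bullet> b = h x" for b
    using assms by (intro completion_ex_borel_measurable_real borel_measurable_inner) auto
  then obtain h where h [measurable]: "\<And>b. h b \<in> borel_measurable M"
    and eq: "\<And>b. AE x in M. g x \<bullet> b = h b x"
    by metis
  have "AE x in M. \<forall>b\<in>Basis. g x \<bullet> b = h b x"
    using eq by (intro AE_finite_allI) auto
  then have "AE x in M. g x = (\<Sum>b\<in>Basis. h b x *\<^sub>R b)"
  proof eventually_elim
    case (elim x)
    have "g x = (\<Sum>b\<in>Basis. (g x \<bullet> b) *\<^sub>R b)"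
      by (simp add: euclidean_representation)
    also have "\<dots> = (\<Sum>b\<in>Basis. h b x *\<^sub>R b)"
      using elim by (intro sum.cong) auto
    finally show ?case .
  qed
  then show ?thesis
    by (intro bexI[of _ "\<lambda>x. \<Sum>b\<in>Basis. h b x *\<^sub>R b"]) measurable
qed

text \<open>Integrating the conditional probability of \<open>C\<close> over the
  \<open>F\<close>-event \<open>P\<close> gives the measure of their intersection, which is 0. A
  function that is positive throughout \<open>P\<close> has integral 0 over it only if
  \<open>P\<close> is null.\<close>

lemma (in finite_measure_subalgebra) AE_not_if_cond_exp_indicator_pos:
  assumes C [measurable]: "C \<in> sets M"
    and P [measurable]: "Measurable.pred F P"
    and pos: "\<And>x. x \<in> space M \<Longrightarrow> P x \<Longrightarrow> 0 < real_cond_exp M F (indicator C) x"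
    and not: "AE x in M. x \<in> C \<longrightarrow> \<not> P x"
  shows "AE x in M. \<not> P x"
proof -
  let ?p = "real_cond_exp M F (indicator C)"
  let ?B = "{x \<in> space M. P x}"
  have spF: "space F = space M"
    using subalg by (simp add: subalgebra_def)
  have BF: "?B \<in> sets F"
    using P unfolding pred_def spF .
  then have B [measurable]: "?B \<in> sets M"
    using subalg by (auto simp: subalgebra_def)
  have int: "integrable M (indicator C :: 'a \<Rightarrow> real)"
    by (simp add: integrable_indicator_iff less_top[symmetric])
  have "(LINT x:?B|M. ?p x) = (LINT x:?B|M. indicator C x)"
    using real_cond_exp_intA[OF int BF] by simp
  also have "\<dots> = (LINT x|M. 0)"
    unfolding set_lebesgue_integral_def
    using not by (intro integral_cong_AE) (auto simp: indicator_def)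
  finally have zero: "(LINT x|M. indicator ?B x *\<^sub>R ?p x) = 0"
    by (simp add: set_lebesgue_integral_def)
  have "AE x in M. indicator ?B x *\<^sub>R ?p x = 0"
  proof (subst integral_nonneg_eq_0_iff_AE[symmetric])
    show "integrable M (\<lambda>x. indicator ?B x *\<^sub>R ?p x)"
      using real_cond_exp_int(1)[OF int] by (intro integrable_mult_indicator) auto
    show "AE x in M. 0 \<le> indicator ?B x *\<^sub>R ?p x"
      by (rule AE_I2) (auto simp: indicator_def intro: less_imp_le pos)
  qed (fact zero)
  moreover have "AE x in M. x \<in> space M"
    by (rule AE_space)
  ultimately show ?thesis
  proof eventually_elim
    case (elim x)
    then show ?case using pos[of x] by (auto simp: indicator_def)
  qed
qed

section \<open>Natural sigma-algebras, their completions and finitely many paths\<close>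

lemma space_natural_sigma [simp]: "space (natural_sigma M X t) = space M"
  by (simp add: natural_sigma_def space_measure_of_conv)

lemma sets_natural_sigma:
  "sets (natural_sigma M X t) =
     sigma_sets (space M) (\<Union>s\<in>{..t}. sets (vimage_algebra (space M) (X s) borel))"
  unfolding natural_sigma_def
  by (intro sets_measure_of) (auto simp: sets_vimage_algebra2 dest!: sets.sets_into_space)

lemma sets_natural_sigma_mono:
  "s \<le> t \<Longrightarrow> sets (natural_sigma M X s) \<subseteq> sets (natural_sigma M X t)"
  unfolding sets_natural_sigma by (intro sigma_sets_mono') (rule UN_mono, auto)

text \<open>A generating event depends on a single \<open>X s\<close>, and complements and countable
  unions of events that do not separate \<open>\<omega>\<close> from \<open>\<omega>'\<close> do not
  separate them either.\<close>

lemma natural_sigma_set_determined_by_path: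
  assumes "A \<in> sets (natural_sigma M X t)" "\<omega> \<in> space M" "\<omega>' \<in> space M"
    and path: "\<And>s. s \<le> t \<Longrightarrow> X s \<omega> = X s \<omega>'"
  shows "\<omega> \<in> A \<longleftrightarrow> \<omega>' \<in> A"
  using assms(1) unfolding sets_natural_sigma
proof (induction A rule: sigma_sets.induct)
  case (Basic A)
  then show ?case
    using assms(2,3) path by (auto simp: sets_vimage_algebra2)
next
  case (Compl A)
  then show ?case using assms(2,3) by auto
qed auto

lemma natural_sigma_measurable_determined_by_path:
  fixes V :: "'a \<Rightarrow> 'b::t1_space"
  assumes "V \<in> borel_measurable (natural_sigma M X t)" "\<omega> \<in> space M" "\<omega>' \<in> space M"
    and "\<And>s. s \<le> t \<Longrightarrow> X s \<omega> = X s \<omega>'"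
  shows "V \<omega> = V \<omega>'"
proof -
  have "V -` {V \<omega>} \<inter> space M \<in> sets (natural_sigma M X t)"
    using measurable_sets[OF assms(1), of "{V \<omega>}"] by simp
  from natural_sigma_set_determined_by_path[OF this assms(2-4)] assms(2,3) show ?thesis
    by auto
qed

context finite_state_process
begin

lemma subalgebra_natural_sigma:
  assumes "t \<le> T"
  shows "subalgebra M (natural_sigma M X t)"
proof -
  have "sets (vimage_algebra (space M) (X s) borel) \<subseteq> sets M" if "s \<le> t" for s
    using X_measurable[of s] assms that
    by (auto simp: sets_vimage_algebra2 intro: measurable_sets)
  then show ?thesis
    unfolding subalgebra_def sets_natural_sigma
    by (auto intro!: sets.sigma_sets_subset)
qed

text \<open>An event of \<open>filt M X t\<close> is a natural event up to a subset of a natural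
  null set at time \<open>t\<close>. Both stay of this kind at time \<open>T\<close>, where the
  completion yields exactly the events of \<open>M\<close>.\<close>

lemma subalgebra_filt:
  assumes t: "t \<le> T"
  shows "subalgebra M (filt M X t)"
proof -
  note R = subalgebra_natural_sigma[OF t] subalgebra_natural_sigma[OF order_refl]
  have "sets (filt M X t) \<subseteq> sets (filt M X T)"
  proof
    fix A assume "A \<in> sets (filt M X t)"
    then obtain S N N' where "A = S \<union> N" "N \<subseteq> N'"
      "N' \<in> null_sets (restr_to_subalg M (natural_sigma M X t))"
      "S \<in> sets (restr_to_subalg M (natural_sigma M X t))"
      unfolding filt_def by (rule sets_completionE)
    with R sets_natural_sigma_mono[OF t, of M X] show "A \<in> sets (filt M X T)"
      unfolding filt_def
      by (intro sets_completionI[of A S N N'])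
         (auto simp: null_sets_restr_to_subalg sets_restr_to_subalg)
  qed
  then show ?thesis
    using sets_eq_filt
    by (simp add: subalgebra_def) (simp add: filt_def space_restr_to_subalg)
qed

text \<open>There are only finitely many paths up to time \<open>t\<close>, and \<open>V\<close>
  factors through the path.\<close>

lemma finite_range_natural_sigma:
  fixes V :: "'a \<Rightarrow> 'b::t1_space"
  assumes t: "t \<le> T" and V: "V \<in> borel_measurable (natural_sigma M X t)"
  shows "finite (V ` space M)"
proof -
  \<comment> \<open>The constant value 0 beyond \<open>t\<close> makes the set of paths finite
    although they are functions on all natural numbers.\<close>
  define path where "path \<omega> s = (if s \<le> t then X s \<omega> else 0)" for \<omega> s
  have "path ` space M \<subseteq>
      {p. \<forall>s. (s \<in> {..t} \<longrightarrow> p s \<in> range (\<lambda>i. axis i 1)) \<and> (s \<notin> {..t} \<longrightarrow> p s = 0)}"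
  proof (intro image_subsetI CollectI allI conjI impI)
    fix \<omega> s assume "\<omega> \<in> space M"
    then show "path \<omega> s \<in> range (\<lambda>i. axis i 1)" if "s \<in> {..t}"
      using X_basis[of s \<omega>] t that by (auto simp: path_def)
    show "path \<omega> s = 0" if "s \<notin> {..t}"
      using that by (simp add: path_def)
  qed
  then have "finite (path ` space M)"
    by (rule finite_subset) (intro finite_set_of_finite_funs finite_imageI finite_atMost finite)
  \<comment> \<open>\<open>inv_into\<close> selects one representative outcome for each
    path.\<close>
  moreover have "V \<omega> = V (inv_into (space M) path (path \<omega>))" if \<omega>: "\<omega> \<in> space M" for \<omega>
  proof (rule natural_sigma_measurable_determined_by_path[OF V \<omega>])
    show "inv_into (space M) path (path \<omega>) \<in> space M"
      using \<omega> by (intro inv_into_into) auto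
    have "path (inv_into (space M) path (path \<omega>)) = path \<omega>"
      using \<omega> by (intro f_inv_into_f) auto
    then show "X s \<omega> = X s (inv_into (space M) path (path \<omega>))" if "s \<le> t" for s
      using that unfolding path_def by (metis (no_types, lifting))
  qed
  then have "V ` space M \<subseteq> (\<lambda>p. V (inv_into (space M) path p)) ` path ` space M"
    by blast
  ultimately show ?thesis
    by (meson finite_imageI finite_subset)
qed

text \<open>A generator is only adapted for fixed arguments and need not be jointly measurable.
  Substituting random arguments is harmless because they have a version with finitely many
  values.\<close>

lemma borel_measurable_filt_compose:
  fixes g :: "'b::euclidean_space \<Rightarrow> 'a \<Rightarrow> real"
  assumes t: "t \<le> T"
    and g: "\<And>u. g u \<in> borel_measurable (filt M X t)"
    and U: "U \<in> borel_measurable (filt M X t)"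
  shows "(\<lambda>\<omega>. g (U \<omega>) \<omega>) \<in> borel_measurable (filt M X t)"
proof -
  let ?R = "restr_to_subalg M (natural_sigma M X t)"
  interpret C: complete_measure "filt M X t"
    unfolding filt_def by (rule completion.complete_measure_axioms)
  obtain U' where U': "U' \<in> borel_measurable ?R" and eq: "AE \<omega> in ?R. U \<omega> = U' \<omega>"
    using completion_ex_borel_measurable_euclidean[OF U[unfolded filt_def]] by auto
  have fin: "finite (U' ` space M)"
    by (rule finite_range_natural_sigma[OF t
          measurable_in_subalg'[OF subalgebra_natural_sigma[OF t] U']])
  have U'_meas: "U' \<in> borel_measurable (filt M X t)"
    unfolding filt_def using U' by (rule measurable_completion)
  have sp: "space (filt M X t) = space M"
    by (simp add: filt_def space_restr_to_subalg)
  \<comment> \<open>With finitely many values, the substitution glues the functions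
    \<open>g u\<close> along the events \<open>U' = u\<close>.\<close>
  have "U' \<in> filt M X t \<rightarrow>\<^sub>M count_space (U' ` space M)"
    unfolding measurable_count_space_eq2[OF fin]
    using measurable_sets[OF U'_meas] sp by auto
  then have "(\<lambda>\<omega>. g (U' \<omega>) \<omega>) \<in> borel_measurable (filt M X t)"
    using g fin
    by (intro measurable_compose_countable'[where f = g and g = U' and I = "U' ` space M"])
       (auto intro: countable_finite)
  moreover have "AE \<omega> in filt M X t. g (U' \<omega>) \<omega> = g (U \<omega>) \<omega>"
    unfolding filt_def using eq by (intro AE_completion) auto
  ultimately show ?thesis
    by (rule C.measurable_cong_AE_borel)
qed

section \<open>The conditional law of the next state\<close>

text \<open>The indicators of the possible next states sum to 1, so almost surely their conditional
  probabilities do too and cannot all be \<le> 0. Hence the minimum over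
  \<open>possible_next\<close> is almost surely attained.\<close>

lemma AE_possible_next_nonempty:
  assumes t: "t < T"
  shows "AE \<omega> in M. possible_next M X t \<omega> \<noteq> {}"
proof -
  interpret F: finite_measure_subalgebra M "filt M X t"
    by unfold_locales (use t in \<open>auto intro: subalgebra_filt\<close>)
  let ?C = "\<lambda>i. {\<omega> \<in> space M. X (Suc t) \<omega> = axis i 1}"
  let ?p = "\<lambda>i. real_cond_exp M (filt M X t) (indicator (?C i))"
  have [measurable]: "X (Suc t) \<in> borel_measurable M"
    using t by (intro X_measurable) auto
  have C [measurable]: "?C i \<in> sets M" for i
    by measurable
  have int: "integrable M (indicator (?C i) :: 'a \<Rightarrow> real)" for i
    by (simp add: integrable_indicator_iff less_top[symmetric])
  have "AE \<omega> in M. real_cond_exp M (filt M X t) (\<lambda>\<omega>. \<Sum>i\<in>UNIV. indicator (?C i) \<omega>) \<omega>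
      = (\<Sum>i\<in>UNIV. ?p i \<omega>)"
    using int by (rule F.real_cond_exp_sum)
  moreover have "AE \<omega> in M. real_cond_exp M (filt M X t) (\<lambda>\<omega>. \<Sum>i\<in>UNIV. indicator (?C i) \<omega>) \<omega>
      = real_cond_exp M (filt M X t) (\<lambda>_. 1) \<omega>"
  proof (rule F.real_cond_exp_cong)
    show "AE \<omega> in M. (\<Sum>i\<in>UNIV. indicator (?C i) \<omega>) = (1::real)"
    proof (rule AE_I2)
      fix \<omega> assume \<omega>: "\<omega> \<in> space M"
      then obtain j where "X (Suc t) \<omega> = axis j 1"
        using X_basis[of "Suc t" \<omega>] t by auto
      then have "indicator (?C i) \<omega> = (if i = j then 1 else 0 :: real)" for i
        using \<omega> by (auto simp: indicator_def axis_eq_axis)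
      then show "(\<Sum>i\<in>UNIV. indicator (?C i) \<omega>) = (1::real)"
        by simp
    qed
  qed measurable
  moreover have "AE \<omega> in M. real_cond_exp M (filt M X t) (\<lambda>_. 1) \<omega> = 1"
    by (rule F.real_cond_exp_F_meas) auto
  ultimately show ?thesis
  proof eventually_elim
    case (elim \<omega>)
    then have "(\<Sum>i\<in>UNIV. ?p i \<omega>) = 1" by simp
    then have "\<not> (\<forall>i. ?p i \<omega> \<le> 0)"
      using sum_nonpos[of UNIV "\<lambda>i. ?p i \<omega>"] by auto
    then show ?case
      by (auto simp: possible_next_def not_le)
  qed
qed

text \<open>If \<open>D\<close> is known at time \<open>t\<close> and dominates the worst case minus the realised value of \<open>h\<close>,
  then it is nonnegative: a minimising state has positive conditional probability, and when it
  is realised the lower bound vanishes.\<close>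

lemma AE_nonneg_if_ge_Min_minus_realised:
  fixes D :: "'a \<Rightarrow> real" and h :: "'m \<Rightarrow> 'a \<Rightarrow> real"
  assumes t: "t < T"
    and D [measurable]: "D \<in> borel_measurable (filt M X t)"
    and h [measurable]: "\<And>i. h i \<in> borel_measurable (filt M X t)"
    and A [measurable]: "Measurable.pred (filt M X t) A"
    and ge: "AE \<omega> in M. \<forall>i. A \<omega> \<longrightarrow> X (Suc t) \<omega> = axis i 1 \<longrightarrow>
               (MIN j\<in>possible_next M X t \<omega>. h j \<omega>) - h i \<omega> \<le> D \<omega>"
  shows "AE \<omega> in M. A \<omega> \<longrightarrow> 0 \<le> D \<omega>"
proof -
  interpret F: finite_measure_subalgebra M "filt M X t"
    by unfold_locales (use t in \<open>auto intro: subalgebra_filt\<close>)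
  let ?Q = "possible_next M X t"
  let ?C = "\<lambda>i. {\<omega> \<in> space M. X (Suc t) \<omega> = axis i 1}"
  \<comment> \<open>The event to be excluded is split according to a minimising state
    \<open>i\<close>. Each piece is known at time \<open>t\<close>, and \<open>i\<close> has
    positive conditional probability on it, so it is null once it almost surely misses the event
    that \<open>i\<close> is realised.\<close>
  define bad where
    "bad i \<omega> \<longleftrightarrow> A \<omega> \<and> D \<omega> < 0 \<and> i \<in> ?Q \<omega> \<and> (\<forall>j. j \<in> ?Q \<omega> \<longrightarrow> h i \<omega> \<le> h j \<omega>)" for i \<omega>
  have X_meas [measurable]: "X (Suc t) \<in> borel_measurable M"
    using t by (intro X_measurable) auto
  have "AE \<omega> in M. \<not> bad i \<omega>" for i
  proof (rule F.AE_not_if_cond_exp_indicator_pos)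
    show "?C i \<in> sets M"
      by measurable
    show "Measurable.pred (filt M X t) (bad i)"
      unfolding bad_def possible_next_def mem_Collect_eq by measurable
    show "0 < real_cond_exp M (filt M X t) (indicator (?C i)) \<omega>" if "bad i \<omega>" for \<omega>
      using that by (simp add: bad_def possible_next_def)
    show "AE \<omega> in M. \<omega> \<in> ?C i \<longrightarrow> \<not> bad i \<omega>"
      using ge
    proof eventually_elim
      case (elim \<omega>)
      show ?case
      proof (intro impI notI)
        assume C: "\<omega> \<in> ?C i" and bad: "bad i \<omega>"
        then have "(MIN j\<in>?Q \<omega>. h j \<omega>) = h i \<omega>"
          by (intro Min_eqI) (auto simp: bad_def)
        with elim C bad show False
          by (auto simp: bad_def)
      qed
    qed
  qed
  then have "AE \<omega> in M. \<forall>i\<in>UNIV. \<not> bad i \<omega>"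
    by (intro AE_finite_allI) auto
  with AE_possible_next_nonempty[OF t] show ?thesis
  proof eventually_elim
    case (elim \<omega>)
    \<comment> \<open>Some minimiser exists, so \<open>A\<close> together with \<open>D < 0\<close>
      would make the outcome bad for it.\<close>
    have "Min ((\<lambda>j. h j \<omega>) ` ?Q \<omega>) \<in> (\<lambda>j. h j \<omega>) ` ?Q \<omega>"
      using elim by (intro Min_in) auto
    then obtain i where "i \<in> ?Q \<omega>" "h i \<omega> = Min ((\<lambda>j. h j \<omega>) ` ?Q \<omega>)"
      by auto
    then have "i \<in> ?Q \<omega>" "\<forall>j. j \<in> ?Q \<omega> \<longrightarrow> h i \<omega> \<le> h j \<omega>"
      by auto
    with elim(2) show ?case
      by (auto simp: bad_def not_less)
  qed
qed

end

section \<open>One-step consequences of the reflected equation\<close>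

lemma rbsde_solution_terminal:
  assumes "rbsde_solution M X T \<xi> f S Y Z K"
  shows "AE \<omega> in M. Y T \<omega> = \<xi> \<omega>"
  using assms by (auto simp: rbsde_solution_def)

lemma rbsde_solution_step:
  assumes sol: "rbsde_solution M X T \<xi> f S Y Z K" and t: "t < T"
  shows "AE \<omega> in M. Y t \<omega> = Y (Suc t) \<omega> + f \<omega> t (Y t \<omega>) (Z t \<omega>) + (K (Suc t) \<omega> - K t \<omega>)
           - Z t \<omega> \<bullet> mart_diff M X (Suc t) \<omega>"
proof -
  have eq: "AE \<omega> in M. Y s \<omega> = \<xi> \<omega> + (\<Sum>u\<in>{s..<T}. f \<omega> u (Y u \<omega>) (Z u \<omega>)) + K T \<omega> - K s \<omega>
      - (\<Sum>u\<in>{s..<T}. Z u \<omega> \<bullet> mart_diff M X (Suc u) \<omega>)" if "s \<le> T" for s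
    using sol that by (simp add: rbsde_solution_def)
  from t have "t \<le> T" "Suc t \<le> T" by auto
  from eq[OF this(1)] eq[OF this(2)] show ?thesis
    by eventually_elim (simp add: sum.atLeast_Suc_lessThan[OF t])
qed

lemma rbsde_solution_increment_nonneg:
  assumes "rbsde_solution M X T \<xi> f S Y Z K" and t: "t < T"
  shows "AE \<omega> in M. K t \<omega> \<le> K (Suc t) \<omega>"
  using assms by (auto simp: rbsde_solution_def elim!: eventually_mono)

text \<open>All terms of the vanishing sum in condition (d) are almost surely nonnegative, so each
  of them is 0.\<close>

lemma rbsde_solution_increment_eq_0:
  assumes sol: "rbsde_solution M X T \<xi> f S Y Z K" and t: "t < T"
  shows "AE \<omega> in M. S t \<omega> < Y t \<omega> \<longrightarrow> K (Suc t) \<omega> = K t \<omega>"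
proof -
  have "AE \<omega> in M. \<forall>s\<in>{..T}. S s \<omega> \<le> Y s \<omega>"
    using sol by (intro AE_finite_allI) (auto simp: rbsde_solution_def)
  moreover have "AE \<omega> in M. (\<forall>s t. s \<le> t \<and> t \<le> T \<longrightarrow> K s \<omega> \<le> K t \<omega>) \<and>
      (\<Sum>s\<in>{0..<T}. (Y s \<omega> - S s \<omega>) * (K (Suc s) \<omega> - K s \<omega>)) = 0"
    using sol by (auto simp: rbsde_solution_def elim!: eventually_mono)
  ultimately show ?thesis
  proof eventually_elim
    case (elim \<omega>)
    have "\<forall>s\<in>{0..<T}. (Y s \<omega> - S s \<omega>) * (K (Suc s) \<omega> - K s \<omega>) = 0"
    proof (subst sum_nonneg_eq_0_iff[symmetric])
      show "0 \<le> (Y s \<omega> - S s \<omega>) * (K (Suc s) \<omega> - K s \<omega>)" if "s \<in> {0..<T}" for s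
        using elim that by (intro mult_nonneg_nonneg) auto
    qed (use elim in auto)
    with t have "(Y t \<omega> - S t \<omega>) * (K (Suc t) \<omega> - K t \<omega>) = 0"
      by simp
    then show ?case by auto
  qed
qed

section \<open>Comparison of the two solutions\<close>

theorem theorem2p8:
  fixes M :: "'a measure" and X :: "nat \<Rightarrow> 'a \<Rightarrow> real ^ 'm" and T :: nat
    and \<xi>1 \<xi>2 :: "'a \<Rightarrow> real"
    and f1 f2 :: "'a \<Rightarrow> nat \<Rightarrow> real \<Rightarrow> real ^ 'm \<Rightarrow> real"
    and S1 S2 Y1 Y2 K1 K2 :: "nat \<Rightarrow> 'a \<Rightarrow> real"
    and Z1 Z2 :: "nat \<Rightarrow> 'a \<Rightarrow> real ^ 'm"
  assumes "finite_state_process M X T"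
    and "standard_data M X T \<xi>1 f1 S1"
    and "standard_data M X T \<xi>2 f2 S2"
    and "rbsde_solution M X T \<xi>1 f1 S1 Y1 Z1 K1"
    and "rbsde_solution M X T \<xi>2 f2 S2 Y2 Z2 K2"
    and i: "AE \<omega> in M. \<xi>1 \<omega> \<ge> \<xi>2 \<omega>"
    and ii: "AE \<omega> in M. \<forall>t\<le>T.
      f1 \<omega> t (Y2 t \<omega>) (Z2 t \<omega>) \<ge> f2 \<omega> t (Y2 t \<omega>) (Z2 t \<omega>)"
    and iii: "AE \<omega> in M. \<forall>t\<le>T. S1 t \<omega> \<ge> S2 t \<omega>"
    and iv: "AE \<omega> in M. \<forall>t<T.
      f1 \<omega> t (Y2 t \<omega>) (Z1 t \<omega>) - f1 \<omega> t (Y2 t \<omega>) (Z2 t \<omega>)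
        \<ge> (MIN i\<in>possible_next M X t \<omega>.
              (Z1 t \<omega> - Z2 t \<omega>) \<bullet> (axis i 1 - vec_cond_exp M (filt M X t) (X (Suc t)) \<omega>))"
    and v: "AE \<omega> in M. \<forall>t\<le>T.
      Y1 t \<omega> - f1 \<omega> t (Y1 t \<omega>) (Z1 t \<omega>) \<ge> Y2 t \<omega> - f1 \<omega> t (Y2 t \<omega>) (Z1 t \<omega>)
        \<longrightarrow> Y1 t \<omega> \<ge> Y2 t \<omega>"
  shows "\<forall>t\<le>T. AE \<omega> in M. Y1 t \<omega> \<ge> Y2 t \<omega>"
proof -
  interpret finite_state_process M X T by fact
  note sol1 = \<open>rbsde_solution M X T \<xi>1 f1 S1 Y1 Z1 K1\<close>
  note sol2 = \<open>rbsde_solution M X T \<xi>2 f2 S2 Y2 Z2 K2\<close>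
  have less_step: "AE \<omega> in M. Y2 t \<omega> \<le> Y1 t \<omega>"
    if t: "t < T" and next_le: "AE \<omega> in M. Y2 (Suc t) \<omega> \<le> Y1 (Suc t) \<omega>" for t
  proof -
    let ?F = "filt M X t"
    let ?E = "vec_cond_exp M ?F (X (Suc t))"
    define A where "A \<omega> \<longleftrightarrow> Y1 t \<omega> < Y2 t \<omega>" for \<omega>
    define D where "D \<omega> = (Y1 t \<omega> - f1 \<omega> t (Y1 t \<omega>) (Z1 t \<omega>))
      - (Y2 t \<omega> - f1 \<omega> t (Y2 t \<omega>) (Z1 t \<omega>))" for \<omega>
    define h where "h i \<omega> = (Z1 t \<omega> - Z2 t \<omega>) \<bullet> (axis i 1 - ?E \<omega>)" for i \<omega>
    have [measurable]: "Y1 t \<in> borel_measurable ?F" "Y2 t \<in> borel_measurable ?F"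
      "Z1 t \<in> borel_measurable ?F" "Z2 t \<in> borel_measurable ?F"
      using sol1 sol2 t by (simp_all add: rbsde_solution_def adapted_def)
    have f1_meas: "(\<lambda>\<omega>. f1 \<omega> t y z) \<in> borel_measurable ?F" for y z
      using \<open>standard_data M X T \<xi>1 f1 S1\<close> t by (simp add: standard_data_def adapted_def)
    \<comment> \<open>The pair \<open>(y, Z1 t)\<close> is substituted at once; \<open>y\<close>
      stays arbitrary because \<open>D\<close> needs both \<open>Y1 t\<close> and
      \<open>Y2 t\<close>.\<close>
    have [measurable]: "(\<lambda>\<omega>. f1 \<omega> t (y \<omega>) (Z1 t \<omega>)) \<in> borel_measurable ?F"
      if [measurable]: "y \<in> borel_measurable ?F" for y
      using borel_measurable_filt_compose[of t "\<lambda>(y, z) \<omega>. f1 \<omega> t y z" "\<lambda>\<omega>. (y \<omega>, Z1 t \<omega>)"]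
        t f1_meas by (simp add: case_prod_beta)
    have [measurable]: "?E \<in> borel_measurable ?F"
      unfolding vec_cond_exp_def
      by (subst borel_measurable_euclidean_space) (auto simp: Basis_vec_def inner_axis)
    have D_meas: "D \<in> borel_measurable ?F"
      unfolding D_def by measurable
    have h_meas: "h i \<in> borel_measurable ?F" for i
      unfolding h_def by measurable
    have A_meas: "Measurable.pred ?F A"
      unfolding A_def by measurable
    have obstacle: "AE \<omega> in M. S1 t \<omega> \<le> Y1 t \<omega>"
      using sol1 t by (simp add: rbsde_solution_def)
    have "AE \<omega> in M. \<forall>i. A \<omega> \<longrightarrow> X (Suc t) \<omega> = axis i 1 \<longrightarrow>
        (MIN j\<in>possible_next M X t \<omega>. h j \<omega>) - h i \<omega> \<le> D \<omega>"
      using rbsde_solution_step[OF sol1 t] rbsde_solution_step[OF sol2 t] next_le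
        rbsde_solution_increment_nonneg[OF sol1 t] rbsde_solution_increment_eq_0[OF sol2 t]
        obstacle ii iii iv
    proof eventually_elim
      case (elim \<omega>)
      show ?case
      proof (intro allI impI)
        fix i assume A: "A \<omega>" and Xi: "X (Suc t) \<omega> = axis i 1"
        \<comment> \<open>The chain is \<open>S2 t \<le> S1 t \<le> Y1 t < Y2 t\<close>, by (iii),
          the first obstacle condition and \<open>A\<close>.\<close>
        have "S2 t \<omega> < Y2 t \<omega>"
          using elim(6,8) A t unfolding A_def by (meson le_less_trans less_imp_le order_trans)
        then have K2: "K2 (Suc t) \<omega> = K2 t \<omega>"
          using elim(5) by blast
        have h: "h i \<omega> = Z1 t \<omega> \<bullet> mart_diff M X (Suc t) \<omega> - Z2 t \<omega> \<bullet> mart_diff M X (Suc t) \<omega>"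
          by (simp add: h_def mart_diff_def Xi inner_diff_left)
        have "f2 \<omega> t (Y2 t \<omega>) (Z2 t \<omega>) \<le> f1 \<omega> t (Y2 t \<omega>) (Z2 t \<omega>)"
          using elim(7) t by simp
        moreover have "(MIN j\<in>possible_next M X t \<omega>. h j \<omega>)
            \<le> f1 \<omega> t (Y2 t \<omega>) (Z1 t \<omega>) - f1 \<omega> t (Y2 t \<omega>) (Z2 t \<omega>)"
          using elim(9) t unfolding h_def by simp
        \<comment> \<open>By the one-step equations, \<open>D + h i\<close> is the sum of
          \<open>Y1 (Suc t) - Y2 (Suc t)\<close>, the increment of \<open>K1\<close>, and
          \<open>f1\<close> at \<open>(Y2 t, Z1 t)\<close> minus \<open>f2\<close> at
          \<open>(Y2 t, Z2 t)\<close>. The first two are nonnegative; inserting \<open>f1\<close> at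
          \<open>(Y2 t, Z2 t)\<close> bounds the last by the minimum.\<close>
        ultimately show "(MIN j\<in>possible_next M X t \<omega>. h j \<omega>) - h i \<omega> \<le> D \<omega>"
          using elim(1-4) K2 unfolding h D_def by linarith
      qed
    qed
    from AE_nonneg_if_ge_Min_minus_realised[OF t D_meas h_meas A_meas this] v show ?thesis
    proof eventually_elim
      case (elim \<omega>)
      with t show ?case
        by (force simp: A_def D_def not_less[symmetric])
    qed
  qed
  show ?thesis
  proof (intro allI impI)
    fix t assume "t \<le> T"
    then show "AE \<omega> in M. Y2 t \<omega> \<le> Y1 t \<omega>"
    proof (induction rule: inc_induct)
      case base
      from rbsde_solution_terminal[OF sol1] rbsde_solution_terminal[OF sol2] i show ?case
        by eventually_elim simp
    next
      case (step n)
      from \<open>n < T\<close> step.IH show ?case by (rule less_step)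
    qed
  qed
qed

end
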